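(* Let $S=(\alpha^*\beta^*\cup\beta^*\gamma^*,\{\alpha,\beta,\gamma\},\alpha<\beta<\gamma)$. Let $\mathbf{w}_2\in\{0,1\}^{\mathbb{N}}$ be the characteristic sequence of the set of squares $\{n^2\mid n\ge 0\}$. Then the boundary sequence $\partial_{\mathbf{w}_2}$ is $S$-automatic. In particular, it is periodic with period $babb$, i.e. $\partial_{\mathbf{w}_2}=(babb)^\omega$ (the first letter being $\partial_{\mathbf{w}_2}[1]$), where $a=\{(0,0),(0,1),(1,0)\}$ and $b=\{0,1\}\times\{0,1\}$.
   Context: For an infinite word $\mathbf{x}$ over a finite alphabet $B$ (indexed from $0$), the boundary sequence is $\partial_{\mathbf{x}}=(\partial_{\mathbf{x}}[n])_{n\ge 1}$ with $\partial_{\mathbf{x}}[n]=\{(\mathbf{x}[i],\mathbf{x}[i+n])\mid i\ge 0\}\subseteq B\times B$. An abstract numeration system is a triple $S=(L,A,<)$ where $L$ is an infinite regular language over a finite alphabet $A$ totally ordered by $<$. Order $L$ genealogically (first by length, then lexicographically); $\mathrm{rep}_S(n)$ is the $(n+1)$st word of $L$ for $n\ge 0$. A deterministic finite automaton with output (DFAO) is a DFA with an output map $\tau$ from its state set to a finite alphabet; its output $\mathcal{A}(w)$ on a word $w$ is $\tau(q)$ with $q$ the state reached by reading $w$ from the initial state. A sequence $\mathbf{y}$ is $S$-automatic if there is a DFAO $\mathcal{A}$ with $\mathbf{y}[n]=\mathcal{A}(\mathrm{rep}_S(n))$ for all $n$ for which $\mathbf{y}[n]$ is defined. *)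

theory Defs
  imports Main "HOL-Library.Indicator_Function" "HOL-Library.Omega_Words_Fun"
begin

section \<open>Boundary sequences\<close>

text \<open>The boundary sequence is indexed from 1. The value at index 0 is an artefact of
  totality and is never used.\<close>

definition boundary :: "'b word \<Rightarrow> nat \<Rightarrow> ('b \<times> 'b) set" where
  "boundary x n = {(x i, x (i + n)) | i. True}"

section \<open>Finite automata\<close>

record ('q, 'a) automaton =
  states :: "'q set"
  letters :: "'a set"
  init :: 'q
  step :: "'q \<Rightarrow> 'a \<Rightarrow> 'q"

record ('q, 'a) dfa = "('q, 'a) automaton" +
  finals :: "'q set"

text \<open>Only the values of the output map on the states matter. As there are finitely many states,
  they form a finite output alphabet.\<close>

record ('q, 'a, 'o) dfao = "('q, 'a) automaton" +
  out :: "'q \<Rightarrow> 'o"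

definition is_automaton :: "('q, 'a, 'm) automaton_scheme \<Rightarrow> bool" where
  "is_automaton M \<longleftrightarrow> finite (states M) \<and> finite (letters M) \<and> init M \<in> states M \<and>
     (\<forall>q\<in>states M. \<forall>a\<in>letters M. step M q a \<in> states M)"

definition reached :: "('q, 'a, 'm) automaton_scheme \<Rightarrow> 'a list \<Rightarrow> 'q" where
  "reached M w = foldl (step M) (init M) w"

definition accepted :: "('q, 'a) dfa \<Rightarrow> 'a list set" where
  "accepted M = {w \<in> lists (letters M). reached M w \<in> finals M}"

definition dfao_output :: "('q, 'a, 'o) dfao \<Rightarrow> 'a list \<Rightarrow> 'o" where
  "dfao_output M w = out M (reached M w)"

text \<open>Below, the existentially quantified automata have natural numbers as states. This is no
  restriction, since a finite state set can be renamed.\<close>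

definition regular :: "'a set \<Rightarrow> 'a list set \<Rightarrow> bool" where
  "regular A L \<longleftrightarrow> (\<exists>M :: (nat, 'a) dfa. is_automaton M \<and> letters M = A \<and> accepted M = L)"

section \<open>Abstract numeration systems\<close>

record 'a numeration_system =
  lang :: "'a list set"
  alphabet :: "'a set"
  less_rel :: "('a \<times> 'a) set"

definition abstract_numeration_system :: "'a numeration_system \<Rightarrow> bool" where
  "abstract_numeration_system S \<longleftrightarrow>
     finite (alphabet S) \<and> less_rel S \<subseteq> alphabet S \<times> alphabet S \<and>
     strict_linear_order_on (alphabet S) (less_rel S) \<and>
     regular (alphabet S) (lang S) \<and> infinite (lang S)"

text \<open>The word of \<open>lang S\<close> with exactly \<open>n\<close> genealogical predecessors in \<open>lang S\<close>. The set of
  predecessors is finite because the alphabet is, and \<open>lenlex\<close> is the genealogical order.\<close>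

definition rep :: "'a numeration_system \<Rightarrow> nat \<Rightarrow> 'a list" where
  "rep S n = (THE w. w \<in> lang S \<and> card {v \<in> lang S. (v, w) \<in> lenlex (less_rel S)} = n)"

text \<open>\<open>D\<close> is the set of indices at which the sequence \<open>y\<close> is defined.\<close>

definition automatic_on :: "nat set \<Rightarrow> 'a numeration_system \<Rightarrow> (nat \<Rightarrow> 'o) \<Rightarrow> bool" where
  "automatic_on D S y \<longleftrightarrow>
     (\<exists>M :: (nat, 'a, 'o) dfao. is_automaton M \<and> letters M = alphabet S \<and>
        (\<forall>n\<in>D. y n = dfao_output M (rep S n)))"

section \<open>The numeration system and the word of the statement\<close>

datatype letter = Alpha | Beta | Gamma

definition conc_lang :: "'a list set \<Rightarrow> 'a list set \<Rightarrow> 'a list set" where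
  "conc_lang K L = {u @ v | u v. u \<in> K \<and> v \<in> L}"

text \<open>Note that \<open>lists {c}\<close> is the language \<open>c\<^sup>*\<close>.\<close>

definition S_abc :: "letter numeration_system" where
  "S_abc = \<lparr>
     lang = conc_lang (lists {Alpha}) (lists {Beta}) \<union> conc_lang (lists {Beta}) (lists {Gamma}),
     alphabet = {Alpha, Beta, Gamma},
     less_rel = {(Alpha, Beta), (Alpha, Gamma), (Beta, Gamma)}\<rparr>"

definition w2 :: "nat word" where
  "w2 = indicator {n\<^sup>2 | n. True}"

definition bnd_a :: "(nat \<times> nat) set" where
  "bnd_a = {(0, 0), (0, 1), (1, 0)}"

definition bnd_b :: "(nat \<times> nat) set" where
  "bnd_b = {0, 1} \<times> {0, 1}"

section \<open>The triple above is an abstract numeration system\<close>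

fun abc_step :: "nat \<Rightarrow> letter \<Rightarrow> nat" where
  "abc_step q Alpha = (if q = 0 \<or> q = 1 then 1 else 5)"
| "abc_step q Beta = (if q = 0 \<or> q = 3 then 3 else if q = 1 \<or> q = 2 then 2 else 5)"
| "abc_step q Gamma = (if q = 0 \<or> q = 3 \<or> q = 4 then 4 else 5)"

lemma Nil_in_conc_lists: "[] \<in> conc_lang (lists {c}) (lists {d})"
  by (auto simp: conc_lang_def)

lemma Cons_in_conc_lists:
  "x # w \<in> conc_lang (lists {c}) (lists {d}) \<longleftrightarrow>
     x = c \<and> w \<in> conc_lang (lists {c}) (lists {d}) \<or> x = d \<and> w \<in> lists {d}"
  (is "?l \<longleftrightarrow> ?r")
proof
  assume ?l
  then obtain u v where "x # w = u @ v" "u \<in> lists {c}" "v \<in> lists {d}"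
    unfolding conc_lang_def by blast
  then show ?r
    unfolding conc_lang_def by (cases u) auto
next
  assume ?r
  then consider u v where "x = c" "w = u @ v" "u \<in> lists {c}" "v \<in> lists {d}"
    | "x = d" "w \<in> lists {d}"
    unfolding conc_lang_def by blast
  then show ?l
  proof cases
    case 1
    then have "x # w = (x # u) @ v" "x # u \<in> lists {c}" by auto
    then show ?thesis using \<open>v \<in> lists {d}\<close> unfolding conc_lang_def by blast
  next
    case 2
    then have "x # w = [] @ (x # w)" "[] \<in> lists {c}" "x # w \<in> lists {d}" by auto
    then show ?thesis unfolding conc_lang_def by blast
  qed
qed

lemma lists_in_conc_lists: "w \<in> lists {c} \<Longrightarrow> w \<in> conc_lang (lists {c}) (lists {d})"
  unfolding conc_lang_def by force

lemma foldl_abc_step: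
  "foldl abc_step 5 w < 5 \<longleftrightarrow> False"
  "foldl abc_step 4 w < 5 \<longleftrightarrow> w \<in> lists {Gamma}"
  "foldl abc_step 2 w < 5 \<longleftrightarrow> w \<in> lists {Beta}"
  "foldl abc_step 3 w < 5 \<longleftrightarrow> w \<in> conc_lang (lists {Beta}) (lists {Gamma})"
  "foldl abc_step 1 w < 5 \<longleftrightarrow> w \<in> conc_lang (lists {Alpha}) (lists {Beta})"
proof -
  show 5: "foldl abc_step 5 w < 5 \<longleftrightarrow> False" for w
  proof (induction w)
    case (Cons x w) then show ?case by (cases x) auto
  qed simp
  show 4: "foldl abc_step 4 w < 5 \<longleftrightarrow> w \<in> lists {Gamma}" for w
  proof (induction w)
    case (Cons x w) then show ?case using 5 by (cases x) auto
  qed simp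
  show 2: "foldl abc_step 2 w < 5 \<longleftrightarrow> w \<in> lists {Beta}" for w
  proof (induction w)
    case (Cons x w) then show ?case using 5 by (cases x) auto
  qed simp
  show "foldl abc_step 3 w < 5 \<longleftrightarrow> w \<in> conc_lang (lists {Beta}) (lists {Gamma})"
  proof (induction w)
    case (Cons x w) then show ?case using 4 5 by (cases x) (auto simp: Cons_in_conc_lists)
  qed (simp add: Nil_in_conc_lists)
  show "foldl abc_step 1 w < 5 \<longleftrightarrow> w \<in> conc_lang (lists {Alpha}) (lists {Beta})"
  proof (induction w)
    case (Cons x w) then show ?case using 2 5 by (cases x) (auto simp: Cons_in_conc_lists)
  qed (simp add: Nil_in_conc_lists)
qed

lemma foldl_abc_step_0: "foldl abc_step 0 w < 5 \<longleftrightarrow> w \<in> lang S_abc"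
proof (cases w)
  case Nil
  then show ?thesis by (simp add: S_abc_def Nil_in_conc_lists)
next
  case (Cons x v)
  show ?thesis
    using Cons foldl_abc_step(2,4)[of v] foldl_abc_step(5)[of v]
      lists_in_conc_lists[of v Beta Gamma]
    by (cases x) (auto simp: S_abc_def Cons_in_conc_lists)
qed

theorem abstract_numeration_system_S_abc: "abstract_numeration_system S_abc"
proof -
  let ?M = "\<lparr>states = {..5}, letters = {Alpha, Beta, Gamma}, init = 0, step = abc_step,
             finals = {..<5}\<rparr> :: (nat, letter) dfa"
  have lists: "w \<in> lists {Alpha, Beta, Gamma}" for w
    using letter.exhaust by auto
  have "abc_step q x \<le> 5" for q x
    by (cases x) auto
  then have "is_automaton ?M"
    by (simp add: is_automaton_def)
  moreover have "accepted ?M = lang S_abc"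
    using lists by (auto simp: accepted_def reached_def foldl_abc_step_0)
  ultimately have "regular (alphabet S_abc) (lang S_abc)"
    unfolding regular_def by (intro exI[of _ ?M]) (simp add: S_abc_def)
  moreover have "infinite (lang S_abc)"
  proof
    assume "finite (lang S_abc)"
    moreover have "range (\<lambda>n. replicate n Beta) \<subseteq> lang S_abc"
    proof -
      have "replicate n Beta \<in> lang S_abc" for n
        using lists_in_conc_lists[of "replicate n Beta" Beta Gamma] by (simp add: S_abc_def in_lists_conv_set)
      then show ?thesis by blast
    qed
    moreover have "inj (\<lambda>n. replicate n Beta)"
      by (auto intro: injI)
    ultimately show False
      using finite_subset finite_imageD infinite_UNIV_nat by blast
  qed
  ultimately show ?thesis
    by (auto simp: abstract_numeration_system_def S_abc_def strict_linear_order_on_def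
        trans_def irrefl_def total_on_def)
qed

end

theory Submission
  imports Defs "HOL-Library.Discrete_Functions"
begin

text \<open>
  An odd number \<open>2 k + 1\<close> is \<open>(k + 1)\<^sup>2 - k\<^sup>2\<close> and a multiple \<open>4 k\<close> of four is
  \<open>(k + 1)\<^sup>2 - (k - 1)\<^sup>2\<close>, whereas \<open>4 k + 2\<close> is not a difference of two squares. So
  \<open>(1, 1)\<close> is missing from the boundary at \<open>n\<close> exactly if \<open>n mod 4 = 2\<close>; the other three pairs
  always occur, because the gaps between consecutive squares grow.

  The language has \<open>2 l + 1\<close> words of length \<open>l\<close>, hence \<open>l\<^sup>2\<close> words of length less than \<open>l\<close>, and
  lexicographic successors arise by changing one \<open>\<alpha>\<close> into \<open>\<beta>\<close> or one \<open>\<beta>\<close> into \<open>\<gamma>\<close>. Therefore the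
  number represented by a word \<open>w\<close> is the square of its length plus the number of its \<open>\<beta>\<close>s plus
  twice the number of its \<open>\<gamma>\<close>s, and a finite automaton can compute this modulo 4.
\<close>

section \<open>The boundary sequence of the squares\<close>

lemma w2_eq_of_bool: "w2 i = of_bool (\<exists>m. i = m\<^sup>2)"
  by (auto simp: w2_def indicator_def)

lemma boundary_w2_iff:
  "(x, y) \<in> boundary w2 n \<longleftrightarrow>
     (\<exists>i. x = of_bool (\<exists>m. i = m\<^sup>2) \<and> y = of_bool (\<exists>m. i + n = m\<^sup>2))"
  by (auto simp: boundary_def w2_eq_of_bool)

lemma between_squares_not_square:
  fixes k :: nat
  assumes "k\<^sup>2 < i" "i < (k + 1)\<^sup>2"
  shows "\<nexists>m. i = m\<^sup>2"
proof
  assume "\<exists>m. i = m\<^sup>2"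
  then obtain m where "i = m\<^sup>2" ..
  with assms have "k < m" "m < k + 1"
    using power_less_imp_less_base[of k 2 m] power_less_imp_less_base[of m 2 "k + 1"] by auto
  then show False by simp
qed

text \<open>The gap from n^2 to (n + 1)^2 is 2 n + 1, so for n \<ge> 1 the place n after n^2 and the
  place n before (n + 1)^2 both hold a nonsquare.\<close>

lemma bnd_a_subset_boundary_w2:
  assumes "n \<ge> 1"
  shows "bnd_a \<subseteq> boundary w2 n"
proof -
  have "\<nexists>m. n\<^sup>2 + n = m\<^sup>2"
    using assms by (intro between_squares_not_square[of n]) (auto simp: power2_eq_square)
  moreover have "\<exists>m. n\<^sup>2 = m\<^sup>2" by blast
  ultimately have "(1, 0) \<in> boundary w2 n"
    unfolding boundary_w2_iff by (intro exI[of _ "n\<^sup>2"]) simp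
  moreover have "(0, 1) \<in> boundary w2 n"
  proof -
    have "\<nexists>m. n\<^sup>2 + n + 1 = m\<^sup>2"
      using assms by (intro between_squares_not_square[of n]) (auto simp: power2_eq_square)
    moreover have "n\<^sup>2 + n + 1 + n = (n + 1)\<^sup>2"
      by (simp add: power2_eq_square)
    ultimately show ?thesis
      unfolding boundary_w2_iff by (intro exI[of _ "n\<^sup>2 + n + 1"]) auto
  qed
  moreover have "(0, 0) \<in> boundary w2 n"
  proof -
    \<comment> \<open>The next gap holds 2 n + 2 nonsquares, enough room for two places at distance
      n.\<close>
    have "\<nexists>m. (n + 1)\<^sup>2 + 1 = m\<^sup>2" "\<nexists>m. (n + 1)\<^sup>2 + 1 + n = m\<^sup>2"
      by (intro between_squares_not_square[of "n + 1"]; simp add: power2_eq_square)+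
    then show ?thesis
      unfolding boundary_w2_iff by (intro exI[of _ "(n + 1)\<^sup>2 + 1"]) auto
  qed
  ultimately show ?thesis by (simp add: bnd_a_def)
qed

lemma square_mod_4: "(m :: nat)\<^sup>2 mod 4 = m mod 2"
proof (cases "even m")
  case True
  then obtain k where "m = 2 * k" ..
  then show ?thesis by (simp add: power2_eq_square)
next
  case False
  then obtain k where "m = 2 * k + 1" by (rule oddE)
  then have "m\<^sup>2 = 4 * (k * k + k) + 1" by (simp add: power2_eq_square)
  with False show ?thesis by (simp only: mod_mult_self4 odd_iff_mod_2_eq_one) simp
qed

lemma difference_of_squares_iff:
  assumes "n \<ge> (1 :: nat)"
  shows "(\<exists>k m. k\<^sup>2 + n = m\<^sup>2) \<longleftrightarrow> n mod 4 \<noteq> 2"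
proof
  assume "\<exists>k m. k\<^sup>2 + n = m\<^sup>2"
  then obtain k m where "k\<^sup>2 + n = m\<^sup>2" by blast
  \<comment> \<open>If n were 2 modulo 4, the left side would be 2 or 3, while the right side is 0
    or 1.\<close>
  then have "(k mod 2 + n) mod 4 = m mod 2"
    using mod_add_left_eq[of "k\<^sup>2" 4 n] by (simp add: square_mod_4)
  moreover have "k mod 2 = 0 \<or> k mod 2 = 1" "m mod 2 = 0 \<or> m mod 2 = 1" by auto
  ultimately show "n mod 4 \<noteq> 2" by (elim disjE) (simp_all, presburger+)
next
  assume "n mod 4 \<noteq> 2"
  then have "odd n \<or> 4 dvd n" by presburger
  then consider j where "n = 2 * j + 1" | j where "n = 4 * j" "j \<ge> 1"
    using assms by (auto elim!: oddE dvdE)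
  then show "\<exists>k m. k\<^sup>2 + n = m\<^sup>2"
  proof cases
    case (1 j)
    then have "j\<^sup>2 + n = (j + 1)\<^sup>2" by (simp add: power2_eq_square)
    then show ?thesis by blast
  next
    case (2 j)
    \<comment> \<open>The subtraction is not truncated, since j \<ge> 1.\<close>
    then have "(j - 1)\<^sup>2 + n = (j + 1)\<^sup>2"
      by (auto simp: power2_eq_square dest!: le_Suc_ex)
    then show ?thesis by blast
  qed
qed

lemma boundary_w2:
  assumes "n \<ge> 1"
  shows "boundary w2 n = (if n mod 4 = 2 then bnd_a else bnd_b)"
proof -
  have "(1, 1) \<in> boundary w2 n \<longleftrightarrow> (\<exists>k m. k\<^sup>2 + n = m\<^sup>2)"
    by (auto simp: boundary_w2_iff)
  then have iff: "(1, 1) \<in> boundary w2 n \<longleftrightarrow> n mod 4 \<noteq> 2"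
    using difference_of_squares_iff[OF assms] by simp
  have sub: "boundary w2 n \<subseteq> bnd_b"
    by (auto simp: boundary_w2_iff bnd_b_def)
  have bnd_b: "bnd_b = insert (1, 1) bnd_a"
    by (auto simp: bnd_a_def bnd_b_def)
  note sup = bnd_a_subset_boundary_w2[OF assms]
  show ?thesis
  proof (cases "n mod 4 = 2")
    case True
    then have "boundary w2 n = bnd_a" using iff sub sup unfolding bnd_b by blast
    with True show ?thesis by simp
  next
    case False
    then have "boundary w2 n = bnd_b" using iff sub sup unfolding bnd_b by blast
    with False show ?thesis by simp
  qed
qed

section \<open>The representation of a number\<close>

text \<open>By transitivity, increasing steps make all of \<open>g\<close> strictly increasing, so
  the predecessors of \<open>g i\<close> in the language are exactly the \<open>i\<close> words
  \<open>g 0\<close>, ..., \<open>g (i - 1)\<close>.\<close>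

lemma rep_eqI:
  assumes irrefl: "irrefl (less_rel S)" and trans: "trans (less_rel S)"
    and range: "range g = lang S"
    and Suc: "\<And>n. (g n, g (Suc n)) \<in> lenlex (less_rel S)"
  shows "rep S n = g n"
proof -
  have mono: "(g i, g j) \<in> lenlex (less_rel S)" if "i < j" for i j
    using that by (induction rule: less_Suc_induct) (auto intro: Suc lenlex_trans trans)
  have irrefl': "(w, w) \<notin> lenlex (less_rel S)" for w
    using irrefl by (intro lenlex_irreflexive) (simp add: irrefl_def)
  have iff: "(g i, g j) \<in> lenlex (less_rel S) \<longleftrightarrow> i < j" for i j
    using mono irrefl' lenlex_trans[OF _ _ trans] by (metis linorder_cases)
  have "inj g"
    using mono irrefl' by (intro injI) (metis linorder_cases)
  have card: "card {v \<in> lang S. (v, g i) \<in> lenlex (less_rel S)} = i" for i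
  proof -
    have "{v \<in> lang S. (v, g i) \<in> lenlex (less_rel S)} = g ` {..<i}"
      by (auto simp: iff simp flip: range)
    then show ?thesis
      using \<open>inj g\<close> by (simp add: card_image inj_on_subset)
  qed
  show ?thesis
    unfolding rep_def
    by (rule the_equality) (use card in \<open>auto simp flip: range\<close>)
qed

text \<open>For \<open>r \<le> 2 * l\<close>, the word of length \<open>l\<close> with lexicographic
  rank \<open>r\<close>, counted from 0. Truncated subtraction merges two shapes: no \<gamma> occurs
  while \<open>r \<le> l\<close>, no \<alpha> once \<open>r \<ge> l\<close>.\<close>

definition abc_word :: "nat \<Rightarrow> nat \<Rightarrow> letter list" where
  "abc_word l r =
     replicate (l - r) Alpha @ replicate (min r (2 * l - r)) Beta @ replicate (r - l) Gamma"

lemma length_abc_word: "r \<le> 2 * l \<Longrightarrow> length (abc_word l r) = l"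
  by (simp add: abc_word_def)

lemma lists_singleton: "lists {c} = range (\<lambda>n. replicate n c)"
proof (intro equalityI subsetI)
  fix w assume "w \<in> lists {c}"
  then have "w = replicate (length w) c"
    by (auto intro: replicate_eqI)
  then show "w \<in> range (\<lambda>n. replicate n c)" by blast
qed auto

lemma lang_S_abc: "lang S_abc = {abc_word l r | l r. r \<le> 2 * l}"
proof (intro equalityI subsetI)
  fix w assume "w \<in> lang S_abc"
  then consider i j where "w = replicate i Alpha @ replicate j Beta"
    | i j where "w = replicate i Beta @ replicate j Gamma"
    by (auto simp: S_abc_def conc_lang_def lists_singleton)
  then show "w \<in> {abc_word l r | l r. r \<le> 2 * l}"
  proof cases
    case (1 i j)
    then have "w = abc_word (i + j) j" by (simp add: abc_word_def)
    then show ?thesis by (intro CollectI exI[of _ "i + j"] exI[of _ j]) simp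
  next
    case (2 i j)
    \<comment> \<open>The rank counts each \<beta> once and each \<gamma> twice.\<close>
    then have "w = abc_word (i + j) (i + 2 * j)" by (simp add: abc_word_def)
    then show ?thesis by (intro CollectI exI[of _ "i + j"] exI[of _ "i + 2 * j"]) simp
  qed
next
  fix w assume "w \<in> {abc_word l r | l r. r \<le> 2 * l}"
  then obtain l r where w: "w = abc_word l r" by blast
  show "w \<in> lang S_abc"
  proof (cases "r \<le> l")
    case True
    then have "w = replicate (l - r) Alpha @ replicate r Beta"
      by (simp add: w abc_word_def)
    then show ?thesis
      unfolding S_abc_def conc_lang_def lists_singleton by auto
  next
    case False
    then have "w = replicate (2 * l - r) Beta @ replicate (r - l) Gamma"
      by (simp add: w abc_word_def)
    then have "w \<in> conc_lang (lists {Beta}) (lists {Gamma})"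
      unfolding conc_lang_def lists_singleton by blast
    then show ?thesis
      by (simp add: S_abc_def)
  qed
qed

lemma abc_word_lenlex_Suc:
  assumes "r < 2 * l"
  shows "(abc_word l r, abc_word l (Suc r)) \<in> lenlex (less_rel S_abc)"
proof -
  have "(abc_word l r, abc_word l (Suc r)) \<in> lex (less_rel S_abc)"
  proof (cases "r < l")
    case True
    \<comment> \<open>It is the last \<alpha> that turns into \<beta>; prefix and tail stay the
      same. In the other case it is the last \<beta> that turns into \<gamma>.\<close>
    then obtain i where "l = r + Suc i" using less_iff_Suc_add by auto
    then have "abc_word l r = replicate i Alpha @ Alpha # replicate r Beta"
      "abc_word l (Suc r) = replicate i Alpha @ Beta # replicate r Beta"
      by (simp_all add: abc_word_def replicate_app_Cons_same)
    then show ?thesis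
      by (auto intro!: lex_append_leftI simp: S_abc_def)
  next
    case False
    then obtain j where j: "r = l + j" using le_iff_add by (meson not_less)
    with assms obtain i where "l = j + Suc i" using less_iff_Suc_add by auto
    with j have "abc_word l r = replicate i Beta @ Beta # replicate j Gamma"
      "abc_word l (Suc r) = replicate i Beta @ Gamma # replicate j Gamma"
      by (simp_all add: abc_word_def replicate_app_Cons_same)
    then show ?thesis
      by (auto intro!: lex_append_leftI simp: S_abc_def)
  qed
  with assms show ?thesis
    by (simp add: lenlex_conv length_abc_word)
qed

lemma square_add_cases:
  fixes n :: nat
  obtains l r where "n = l\<^sup>2 + r" "r \<le> 2 * l"
proof
  show "n = (floor_sqrt n)\<^sup>2 + (n - (floor_sqrt n)\<^sup>2)" by simp
  show "n - (floor_sqrt n)\<^sup>2 \<le> 2 * floor_sqrt n"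
    using Suc_floor_sqrt_power2_gt[of n] by (simp add: power2_eq_square)
qed

lemma rep_S_abc:
  assumes "r \<le> 2 * l"
  shows "rep S_abc (l\<^sup>2 + r) = abc_word l r"
proof -
  define g where "g n = abc_word (floor_sqrt n) (n - (floor_sqrt n)\<^sup>2)" for n
  have g: "g (l\<^sup>2 + r) = abc_word l r" if "r \<le> 2 * l" for l r
  proof -
    have "floor_sqrt (l\<^sup>2 + r) = l"
      by (rule floor_sqrt_unique) (use that in \<open>simp_all add: power2_eq_square\<close>)
    then show ?thesis by (simp add: g_def)
  qed
  have "rep S_abc n = g n" for n
  proof (rule rep_eqI)
    show "irrefl (less_rel S_abc)" "trans (less_rel S_abc)"
      by (auto simp: S_abc_def irrefl_def trans_def)
    show "range g = lang S_abc"
    proof (intro equalityI subsetI)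
      fix w assume "w \<in> range g"
      then obtain n where "w = g n" by blast
      then show "w \<in> lang S_abc"
        by (cases n rule: square_add_cases) (auto simp: lang_S_abc g)
    next
      fix w assume "w \<in> lang S_abc"
      then obtain l r where "w = abc_word l r" "r \<le> 2 * l"
        by (auto simp: lang_S_abc)
      then show "w \<in> range g"
        using g by (metis rangeI)
    qed
    show "(g n, g (Suc n)) \<in> lenlex (less_rel S_abc)" for n
    proof -
      obtain l r where n: "n = l\<^sup>2 + r" and r: "r \<le> 2 * l" by (rule square_add_cases)
      show ?thesis
      proof (cases "r < 2 * l")
        case True
        then have "g (Suc n) = abc_word l (Suc r)"
          using g[of "Suc r" l] by (simp add: n)
        with True show ?thesis
          by (simp add: n g abc_word_lenlex_Suc)
      next
        case False
        \<comment> \<open>Here \<open>r = 2 * l\<close>: the last word of length \<open>l\<close> is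
          followed by the first word of length \<open>l + 1\<close>, and the lengths alone decide
          the order.\<close>
        with r have "Suc n = (Suc l)\<^sup>2 + 0" by (simp add: n power2_eq_square)
        then have "g (Suc n) = abc_word (Suc l) 0" using g by (metis le0)
        with r show ?thesis
          by (simp add: n g lenlex_conv length_abc_word)
      qed
    qed
  qed
  with g[OF assms] show ?thesis by simp
qed

section \<open>Computing modulo 4\<close>

fun letter_weight :: "letter \<Rightarrow> nat" where
  "letter_weight Alpha = 0"
| "letter_weight Beta = 1"
| "letter_weight Gamma = 2"

lemma sum_letter_weight_abc_word:
  "r \<le> 2 * l \<Longrightarrow> (\<Sum>x\<leftarrow>abc_word l r. letter_weight x) = r"
  by (auto simp: abc_word_def sum_list_replicate)

text \<open>A state \<open>q < 8\<close> stores the parity of the length in \<open>q div 4\<close> and the weight modulo 4 in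
  \<open>q mod 4\<close>. The parity is all that is needed because \<open>l\<^sup>2 mod 4 = l mod 2\<close>.\<close>

definition mod4_step :: "nat \<Rightarrow> letter \<Rightarrow> nat" where
  "mod4_step q x = 4 * ((q div 4 + 1) mod 2) + (q + letter_weight x) mod 4"

lemma foldl_mod4_step:
  "foldl mod4_step 0 w = 4 * (length w mod 2) + (\<Sum>x\<leftarrow>w. letter_weight x) mod 4"
proof (induction w rule: rev_induct)
  case (snoc x w)
  \<comment> \<open>The parity part of a state is a multiple of 4, so adding a weight to the whole
    state does no harm modulo 4.\<close>
  have "(4 * p + s mod 4 + t) mod 4 = (s + t) mod 4" for p s t :: nat
    using mod_mult_self4[of 4 p "s mod 4 + t"] by (simp add: mod_add_left_eq add.assoc)
  with snoc show ?case
    by (simp add: mod4_step_def mod_Suc_eq)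
qed simp

lemma mod_4_automatic: "automatic_on D S_abc (\<lambda>n. f (n mod 4))"
proof -
  define M :: "(nat, letter, 'a) dfao" where
    "M = \<lparr>states = {..<8}, letters = {Alpha, Beta, Gamma}, init = 0, step = mod4_step,
          out = (\<lambda>q. f ((q div 4 + q) mod 4))\<rparr>"
  have "mod4_step q x < 8" for q x
    using mod_less_divisor[of 2 "q div 4 + 1"] mod_less_divisor[of 4 "q + letter_weight x"]
    unfolding mod4_step_def by linarith
  then have "is_automaton M"
    by (simp add: is_automaton_def M_def)
  moreover have "f (n mod 4) = dfao_output M (rep S_abc n)" for n
  proof -
    obtain l r where n: "n = l\<^sup>2 + r" and r: "r \<le> 2 * l" by (rule square_add_cases)
    have "(l\<^sup>2 + r) mod 4 = (l mod 2 + r) mod 4"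
      by (metis mod_add_left_eq square_mod_4)
    moreover have "((4 * p + r mod 4) div 4 + (4 * p + r mod 4)) mod 4 = (p + r) mod 4" for p
      using mod_mult_self4[of 4 p "p + r mod 4"] by (simp add: mod_add_right_eq add.left_commute)
    ultimately show ?thesis
      by (simp add: n r rep_S_abc dfao_output_def reached_def M_def foldl_mod4_step
          length_abc_word sum_letter_weight_abc_word)
  qed
  moreover have "letters M = alphabet S_abc"
    by (simp add: M_def S_abc_def)
  ultimately show ?thesis
    unfolding automatic_on_def by blast
qed

theorem proposition3p8:
  shows "automatic_on {1..} S_abc (boundary w2) \<and>
    (\<lambda>n. boundary w2 (n + 1)) = [bnd_b, bnd_a, bnd_b, bnd_b]\<^sup>\<omega>"
proof
  have "automatic_on {1..} S_abc (\<lambda>n. if n mod 4 = 2 then bnd_a else bnd_b)"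
    by (rule mod_4_automatic)
  then show "automatic_on {1..} S_abc (boundary w2)"
    by (simp add: automatic_on_def boundary_w2)
  show "(\<lambda>n. boundary w2 (n + 1)) = [bnd_b, bnd_a, bnd_b, bnd_b]\<^sup>\<omega>"
  proof
    fix n :: nat
    \<comment> \<open>The periodic word is indexed from 0 and the boundary sequence from 1, which
      puts \<open>bnd_a\<close> at position 1 of the period.\<close>
    have "(n + 1) mod 4 = 2 \<longleftrightarrow> n mod 4 = 1" by presburger
    moreover have "n mod 4 \<in> {0, 1, 2, 3}" by auto
    ultimately show "boundary w2 (n + 1) = [bnd_b, bnd_a, bnd_b, bnd_b]\<^sup>\<omega> n"
      by (auto simp: boundary_w2)
  qed
qed

end
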